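(* (Weak duality) For the gauge optimization problem (P) and its dual (D) defined in the context, the inequality $$c^T x + d^T \mathcal{G}(x) \;\geq\; b^T u - p^T v$$ holds for every feasible point $x \in \mathbb{R}^n$ of (P) and every feasible point $(u,v) \in \mathbb{R}^k \times \mathbb{R}^\ell$ of (D).
   Context: Vector inequalities are componentwise. The index set $\{1,\dots,n\}$ is partitioned into pairwise disjoint sets $I_1,\dots,I_m$ with $\#I_i=n_i$, $n=n_1+\cdots+n_m$; $x_{I_i}\in\mathbb{R}^{n_i}$ is the corresponding subvector of $x\in\mathbb{R}^n$. A gauge function is a function $g:\mathbb{R}^q\to\mathbb{R}\cup\{\infty\}$ that is convex, nonnegative, positively homogeneous ($g(\lambda x)=\lambda g(x)$ for all $x$ and $\lambda>0$) and satisfies $g(0)=0$. A vector gauge function is $\mathcal{G}(x)=(g_1(x_{I_1}),\dots,g_m(x_{I_m}))^T$ with each $g_i:\mathbb{R}^{n_i}\to\mathbb{R}\cup\{\infty\}$ a gauge function; $\mathrm{dom}\,\mathcal{G}=\{x : g_i(x_{I_i})<\infty,\ i=1,\dots,m\}$. The polar of $g_i$ is $g_i^\circ(y)=\sup\{x^Ty : g_i(x)\le 1\}$, and $\mathcal{G}^\circ(y)=(g_1^\circ(y_{I_1}),\dots,g_m^\circ(y_{I_m}))^T$. Given $c\in\mathbb{R}^n$, $d\in\mathbb{R}^m$, $b\in\mathbb{R}^k$, $p\in\mathbb{R}^\ell$, $A\in\mathbb{R}^{k\times n}$, $H\in\mathbb{R}^{\ell\times n}$, $K\in\mathbb{R}^{\ell\times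 m}$ and a vector gauge function $\mathcal{G}$: (P): minimize $c^Tx+d^T\mathcal{G}(x)$ subject to $Ax=b$, $Hx+K\mathcal{G}(x)\le p$, $x\in\mathrm{dom}\,\mathcal{G}$. (D): maximize $b^Tu-p^Tv$ over $(u,v)\in\mathbb{R}^k\times\mathbb{R}^\ell$ subject to $\mathcal{G}^\circ(A^Tu-H^Tv-c)-K^Tv\le d$, $v\ge 0$. *)

theory Defs
  imports
    "HOL-Library.Extended_Real"
    "HOL-Library.Disjoint_Sets"
    "Jordan_Normal_Form.Matrix"
    "Jordan_Normal_Form.DL_Missing_Sublist"
begin

(* Indices are 0-based: {..<n} and {..<m} stand for {1,...,n} and {1,...,m}.
   Componentwise inequalities are the library order on vec, which also requires equal
   dimensions. *)

definition index_partition :: "nat \<Rightarrow> nat \<Rightarrow> (nat \<Rightarrow> nat set) \<Rightarrow> bool" where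
  "index_partition n m I \<longleftrightarrow>
     disjoint_family_on I {..<m} \<and> (\<Union>i<m. I i) = {..<n}"

(* pick J j is the j-th smallest element of J, so the entries of x with index in J are
   kept in increasing order. *)
definition subvec :: "'a vec \<Rightarrow> nat set \<Rightarrow> 'a vec" where
  "subvec x J = vec (card J) (\<lambda>j. x $ pick J j)"

(* Nonnegativity excludes the value -\<infinity>, so g maps into the reals extended by +\<infinity>.
   With t strictly between 0 and 1, and r > 0, no product 0 * \<infinity> with a zero scalar
   arises. *)
definition gauge_function :: "nat \<Rightarrow> (real vec \<Rightarrow> ereal) \<Rightarrow> bool" where
  "gauge_function q g \<longleftrightarrow>
     (\<forall>x \<in> carrier_vec q. \<forall>y \<in> carrier_vec q. \<forall>t::real. 0 < t \<and> t < 1 \<longrightarrow>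
        g (t \<cdot>\<^sub>v x + (1 - t) \<cdot>\<^sub>v y) \<le> ereal t * g x + ereal (1 - t) * g y) \<and>
     (\<forall>x \<in> carrier_vec q. 0 \<le> g x) \<and>
     (\<forall>x \<in> carrier_vec q. \<forall>r::real. 0 < r \<longrightarrow> g (r \<cdot>\<^sub>v x) = ereal r * g x) \<and>
     g (0\<^sub>v q) = 0"

definition polar :: "nat \<Rightarrow> (real vec \<Rightarrow> ereal) \<Rightarrow> real vec \<Rightarrow> ereal" where
  "polar q g y = (SUP x \<in> {x \<in> carrier_vec q. g x \<le> 1}. ereal (x \<bullet> y))"

definition vector_gauge ::
  "nat \<Rightarrow> (nat \<Rightarrow> nat set) \<Rightarrow> (nat \<Rightarrow> real vec \<Rightarrow> ereal) \<Rightarrow> real vec \<Rightarrow> ereal vec" where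
  "vector_gauge m I g x = vec m (\<lambda>i. g i (subvec x (I i)))"

definition vector_polar ::
  "nat \<Rightarrow> (nat \<Rightarrow> nat set) \<Rightarrow> (nat \<Rightarrow> real vec \<Rightarrow> ereal) \<Rightarrow> real vec \<Rightarrow> ereal vec" where
  "vector_polar m I g y = vec m (\<lambda>i. polar (card (I i)) (g i) (subvec y (I i)))"

definition gauge_dom ::
  "nat \<Rightarrow> nat \<Rightarrow> (nat \<Rightarrow> nat set) \<Rightarrow> (nat \<Rightarrow> real vec \<Rightarrow> ereal) \<Rightarrow> real vec set" where
  "gauge_dom n m I g = {x \<in> carrier_vec n. \<forall>i<m. g i (subvec x (I i)) < \<infinity>}"

(* The real vector of values of the vector gauge; only meaningful on gauge_dom, because
   real_of_ereal sends \<infinity> to 0. *)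
definition gauge_val ::
  "nat \<Rightarrow> (nat \<Rightarrow> nat set) \<Rightarrow> (nat \<Rightarrow> real vec \<Rightarrow> ereal) \<Rightarrow> real vec \<Rightarrow> real vec" where
  "gauge_val m I g x = map_vec real_of_ereal (vector_gauge m I g x)"

definition primal_feasible ::
  "nat \<Rightarrow> nat \<Rightarrow> (nat \<Rightarrow> nat set) \<Rightarrow> (nat \<Rightarrow> real vec \<Rightarrow> ereal) \<Rightarrow>
   real mat \<Rightarrow> real vec \<Rightarrow> real mat \<Rightarrow> real mat \<Rightarrow> real vec \<Rightarrow> real vec set" where
  "primal_feasible n m I g A b H K p =
     {x \<in> gauge_dom n m I g.
        A *\<^sub>v x = b \<and> H *\<^sub>v x + K *\<^sub>v gauge_val m I g x \<le> p}"

definition primal_objective ::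
  "nat \<Rightarrow> (nat \<Rightarrow> nat set) \<Rightarrow> (nat \<Rightarrow> real vec \<Rightarrow> ereal) \<Rightarrow>
   real vec \<Rightarrow> real vec \<Rightarrow> real vec \<Rightarrow> real" where
  "primal_objective m I g c d x = c \<bullet> x + d \<bullet> gauge_val m I g x"

(* The first constraint is an inequality between extended-real vectors, so it forces every
   component of the vector polar to be finite. *)
definition dual_feasible ::
  "nat \<Rightarrow> nat \<Rightarrow> nat \<Rightarrow> (nat \<Rightarrow> nat set) \<Rightarrow> (nat \<Rightarrow> real vec \<Rightarrow> ereal) \<Rightarrow>
   real mat \<Rightarrow> real mat \<Rightarrow> real mat \<Rightarrow> real vec \<Rightarrow> real vec \<Rightarrow> (real vec \<times> real vec) set" where
  "dual_feasible m k l I g A H K c d =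
     {(u, v). u \<in> carrier_vec k \<and> v \<in> carrier_vec l \<and>
        vector_polar m I g (transpose_mat A *\<^sub>v u - transpose_mat H *\<^sub>v v - c)
          - map_vec ereal (transpose_mat K *\<^sub>v v) \<le> map_vec ereal d \<and>
        0\<^sub>v l \<le> v}"

definition dual_objective :: "real vec \<Rightarrow> real vec \<Rightarrow> real vec \<Rightarrow> real vec \<Rightarrow> real" where
  "dual_objective b p u v = b \<bullet> u - p \<bullet> v"

end

theory Submission
  imports Defs
begin

text \<open>Put \<open>w = A\<^sup>T u - H\<^sup>T v - c\<close>. The polar inequality on each block, summed over the partition,
  gives \<open>x \<bullet> w \<le> \<G>(x) \<bullet> \<G>\<degree>(w) \<le> \<G>(x) \<bullet> (d + K\<^sup>T v)\<close>. Expanding \<open>x \<bullet> w = b \<bullet> u - v \<bullet> H x - c \<bullet> x\<close>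
  and using \<open>v \<ge> 0\<close> together with \<open>H x + K \<G>(x) \<le> p\<close> yields the claim.\<close>

lemma subvec_carrier [simp]: "subvec x J \<in> carrier_vec (card J)"
  by (simp add: subvec_def)

text \<open>\<open>pick J\<close> is strictly increasing on indices below \<open>card J\<close>,
  hence injective, and every element of \<open>J\<close> is reached at its rank.\<close>

lemma bij_betw_pick:
  assumes "finite J"
  shows "bij_betw (pick J) {..<card J} J"
proof (rule bij_betwI')
  fix i j assume "i \<in> {..<card J}" "j \<in> {..<card J}"
  then show "pick J i = pick J j \<longleftrightarrow> i = j"
    by (metis lessThan_iff less_irrefl linorder_neqE_nat pick_mono)
next
  fix i assume "i \<in> {..<card J}"
  then show "pick J i \<in> J" by (simp add: pick_in_set)
next
  fix a assume a: "a \<in> J"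
  \<comment> \<open>The 0-based rank of \<open>a\<close> is the number of smaller elements of
    \<open>J\<close>; it stays below \<open>card J\<close> because \<open>a\<close> itself is not
    counted.\<close>
  then have "card {e \<in> J. e < a} < card J"
    using assms by (intro psubset_card_mono) auto
  then show "\<exists>i\<in>{..<card J}. a = pick J i"
    using pick_card_in_set[OF a] by (metis lessThan_iff)
qed

lemma scalar_prod_subvec:
  assumes "finite J"
  shows "subvec x J \<bullet> subvec y J = (\<Sum>j\<in>J. x $ j * y $ j)"
proof -
  have "subvec x J \<bullet> subvec y J = (\<Sum>i<card J. x $ pick J i * y $ pick J i)"
    by (simp add: scalar_prod_def subvec_def atLeast0LessThan)
  also have "\<dots> = (\<Sum>j\<in>J. x $ j * y $ j)"
    by (rule sum.reindex_bij_betw[OF bij_betw_pick[OF assms]])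
  finally show ?thesis .
qed

text \<open>The blocks are finite, disjoint and cover \<open>{..<n}\<close>, so the sum over all
  indices regroups into sums over blocks.\<close>

lemma scalar_prod_index_partition:
  assumes "index_partition n m I" and "y \<in> carrier_vec n"
  shows "x \<bullet> y = (\<Sum>i<m. subvec x (I i) \<bullet> subvec y (I i))"
proof -
  have disj: "disjoint_family_on I {..<m}" and un: "(\<Union>i<m. I i) = {..<n}"
    using assms(1) by (auto simp: index_partition_def)
  have fin: "finite (I i)" if "i < m" for i
    using that un finite_subset[of "I i" "{..<n}"] by blast
  have "x \<bullet> y = (\<Sum>j\<in>(\<Union>i<m. I i). x $ j * y $ j)"
    using assms(2) un by (simp add: scalar_prod_def atLeast0LessThan)
  also have "\<dots> = (\<Sum>i<m. \<Sum>j\<in>I i. x $ j * y $ j)"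
    using disj fin by (intro sum.UNION_disjoint) (auto simp: disjoint_family_on_def)
  also have "\<dots> = (\<Sum>i<m. subvec x (I i) \<bullet> subvec y (I i))"
    using fin by (intro sum.cong) (auto simp: scalar_prod_subvec)
  finally show ?thesis .
qed

text \<open>For \<open>t > a\<close> the point \<open>x / t\<close> satisfies
  \<open>g \<le> 1\<close>, so it competes in the supremum defining the polar and
  \<open>x \<bullet> y \<le> t * s\<close>; then \<open>t\<close> decreases to \<open>a\<close>.
  Real bounds \<open>a\<close> and \<open>s\<close> in place of the values of \<open>g\<close> and
  its polar keep products such as \<open>0 * \<infinity>\<close> out of the conclusion.\<close>

lemma gauge_polar_inequality:
  assumes g: "gauge_function q g"
    and x: "x \<in> carrier_vec q" and y: "y \<in> carrier_vec q"
    and gx: "g x \<le> ereal a" and py: "polar q g y \<le> ereal s"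
  shows "x \<bullet> y \<le> a * s"
proof -
  have "0 \<le> g x" using g x by (auto simp: gauge_function_def)
  then have a: "0 \<le> a" using gx by (metis ereal_less_eq(5) order_trans)
  \<comment> \<open>Scaling by \<open>t > a\<close> rather than by \<open>g x\<close> itself covers the case \<open>g x = 0\<close> as well.\<close>
  have scaled: "x \<bullet> y \<le> t * s" if "a < t" for t
  proof -
    have t: "0 < t" using a that by simp
    have "g ((1 / t) \<cdot>\<^sub>v x) = ereal (1 / t) * g x"
      using g x t by (auto simp: gauge_function_def)
    also have "\<dots> \<le> ereal (1 / t) * ereal a"
      using gx t by (intro ereal_mult_left_mono) auto
    also have "\<dots> \<le> 1" using that t by simp
    finally have "ereal (((1 / t) \<cdot>\<^sub>v x) \<bullet> y) \<le> polar q g y"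
      unfolding polar_def using x by (intro SUP_upper) auto
    then have "((1 / t) \<cdot>\<^sub>v x) \<bullet> y \<le> s"
      using py by (metis ereal_less_eq(3) order_trans)
    then show ?thesis using x y t by (simp add: field_simps)
  qed
  have "((\<lambda>t. t * s) \<longlongrightarrow> a * s) (at_right a)" by (intro tendsto_intros)
  then show ?thesis
    by (rule tendsto_lowerbound)
      (auto intro!: scaled eventually_mono[OF eventually_at_right_less])
qed

theorem corollary1:
  fixes n m k l :: nat
    and I :: "nat \<Rightarrow> nat set"
    and g :: "nat \<Rightarrow> real vec \<Rightarrow> ereal"
    and A H K :: "real mat"
    and b c d p x u v :: "real vec"
  assumes "index_partition n m I"
    and "\<And>i. i < m \<Longrightarrow> gauge_function (card (I i)) (g i)"
    and "c \<in> carrier_vec n"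
    and "d \<in> carrier_vec m"
    and "b \<in> carrier_vec k"
    and "p \<in> carrier_vec l"
    and "A \<in> carrier_mat k n"
    and "H \<in> carrier_mat l n"
    and "K \<in> carrier_mat l m"
    and "x \<in> primal_feasible n m I g A b H K p"
    and "(u, v) \<in> dual_feasible m k l I g A H K c d"
  shows "primal_objective m I g c d x \<ge> dual_objective b p u v"
proof -
  note carrier = assms(3-9)
  define G where "G = gauge_val m I g x"
  define w where "w = transpose_mat A *\<^sub>v u - transpose_mat H *\<^sub>v v - c"
  define z where "z = transpose_mat K *\<^sub>v v"
  have x: "x \<in> carrier_vec n" and fin: "\<And>i. i < m \<Longrightarrow> g i (subvec x (I i)) < \<infinity>"
    and Ax: "A *\<^sub>v x = b" and HK: "H *\<^sub>v x + K *\<^sub>v G \<le> p"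
    using assms(10) by (auto simp: primal_feasible_def gauge_dom_def G_def)
  have u: "u \<in> carrier_vec k" and v: "v \<in> carrier_vec l" and v0: "0\<^sub>v l \<le> v"
    and dual: "vector_polar m I g w - map_vec ereal z \<le> map_vec ereal d"
    using assms(11) by (auto simp: dual_feasible_def w_def z_def)
  have G: "G \<in> carrier_vec m" by (simp add: G_def gauge_val_def vector_gauge_def)
  have w: "w \<in> carrier_vec n" and z: "z \<in> carrier_vec m"
    using carrier u v by (auto simp: w_def z_def)
  have block: "subvec x (I i) \<bullet> subvec w (I i) \<le> G $ i * (d $ i + z $ i)" if i: "i < m" for i
  proof (rule gauge_polar_inequality[OF assms(2)[OF i]])
    \<comment> \<open>Together with \<open>x\<close> lying in the domain, this makes the gauge value
      finite, so \<open>real_of_ereal\<close> does not alter it.\<close>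
    have "0 \<le> g i (subvec x (I i))"
      using assms(2)[OF i] by (auto simp: gauge_function_def)
    then show "g i (subvec x (I i)) \<le> ereal (G $ i)"
      using i fin[OF i] by (auto simp: G_def gauge_val_def vector_gauge_def ereal_real)
    have "polar (card (I i)) (g i) (subvec w (I i)) - ereal (z $ i) \<le> ereal (d $ i)"
      using dual i z carrier(2) by (auto simp: less_eq_vec_def vector_polar_def)
    then show "polar (card (I i)) (g i) (subvec w (I i)) \<le> ereal (d $ i + z $ i)"
      \<comment> \<open>The value \<open>\<infinity>\<close> contradicts the dual constraint, since
        subtracting a real leaves it infinite; for a finite value \<open>z $ i\<close> moves to the
        right.\<close>
      by (cases "polar (card (I i)) (g i) (subvec w (I i))") auto
  qed simp_all
  have "x \<bullet> w \<le> (\<Sum>i<m. G $ i * (d $ i + z $ i))"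
    unfolding scalar_prod_index_partition[OF assms(1) w] by (intro sum_mono block) simp
  also have "\<dots> = d \<bullet> G + z \<bullet> G"
    using G by (simp add: scalar_prod_def atLeast0LessThan algebra_simps sum.distrib)
  also have "z \<bullet> G = v \<bullet> (K *\<^sub>v G)"
    unfolding z_def by (rule transpose_vec_mult_scalar[OF carrier(7) G v])
  finally have upper: "x \<bullet> w \<le> d \<bullet> G + v \<bullet> (K *\<^sub>v G)" .
  have "x \<bullet> w = w \<bullet> x" by (rule comm_scalar_prod[OF x w])
  also have "\<dots> = (transpose_mat A *\<^sub>v u) \<bullet> x - (transpose_mat H *\<^sub>v v) \<bullet> x - c \<bullet> x"
    unfolding w_def using carrier u v x by (simp add: minus_scalar_prod_distrib[of _ n])
  \<comment> \<open>Moving the transposes across the scalar product lets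
    \<open>A *\<^sub>v x = b\<close> enter.\<close>
  also have "\<dots> = b \<bullet> u - v \<bullet> (H *\<^sub>v x) - c \<bullet> x"
    using transpose_vec_mult_scalar[OF carrier(5) x u] transpose_vec_mult_scalar[OF carrier(6) x v]
      Ax comm_scalar_prod[OF u carrier(3)] by simp
  finally have expand: "x \<bullet> w = b \<bullet> u - v \<bullet> (H *\<^sub>v x) - c \<bullet> x" .
  have "v \<bullet> (H *\<^sub>v x) + v \<bullet> (K *\<^sub>v G) = v \<bullet> (H *\<^sub>v x + K *\<^sub>v G)"
    using carrier v x G by (intro scalar_prod_add_distrib[symmetric, of _ l])
      (auto intro: mult_mat_vec_carrier)
  also have "\<dots> \<le> v \<bullet> p"
    using HK v0 v carrier
    by (auto simp: scalar_prod_def less_eq_vec_def intro!: sum_mono mult_left_mono)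
  also have "\<dots> = p \<bullet> v" by (rule comm_scalar_prod[OF v carrier(4)])
  \<comment> \<open>Combining \<open>upper\<close> and \<open>expand\<close> gives \<open>b
    \<bullet> u - c \<bullet> x \<le> d \<bullet> G + v \<bullet> (H *\<^sub>v x) + v \<bullet> (K
    *\<^sub>v G)\<close>, and the last two terms are at most \<open>p \<bullet> v\<close>.\<close>
  finally show ?thesis
    using upper expand by (simp add: primal_objective_def dual_objective_def G_def)
qed

end
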